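(* Let $\mathbf{A} \in \mathbb{R}^{m_1 \times n}$ and $\mathbf{B} \in \mathbb{R}^{m_2 \times n}$ be matrices with the same number of columns, and let $\mathbf{A} \ast \mathbf{B} \in \mathbb{R}^{(m_1 m_2)\times n}$ be their (row-wise) Khatri-Rao product. If there is a vector $\boldsymbol{\alpha} \in \mathbb{R}^n$ without zero entries that satisfies $(\mathbf{A} \ast \mathbf{B})\boldsymbol{\alpha} = \mathbf{1}$, then \[ \operatorname{rank}(\mathbf{A}) + \operatorname{rank}(\mathbf{B}) - 1 \leq n. \]
   Context: The Hadamard product of $\mathbf{u},\mathbf{v}\in\mathbb{R}^n$ is the entrywise product $\mathbf{u}\odot\mathbf{v} = (u_i v_i)_{1\le i\le n}$. Write $\mathbf{A}_i$ for the $i$-th row of a matrix $\mathbf{A}$. The Khatri-Rao product of $\mathbf{A}\in\mathbb{R}^{m_1\times n}$ and $\mathbf{B}\in\mathbb{R}^{m_2\times n}$ is the matrix $\mathbf{A}\ast\mathbf{B} = \mathbf{C}\in\mathbb{R}^{(m_1m_2)\times n}$ with $\mathbf{C}_{(i-1)m_2+j} = \mathbf{A}_i\odot\mathbf{B}_j$ for all $1\le i\le m_1$, $1\le j\le m_2$. $\mathbf{1}$ denotes the all-ones vector (here of length $m_1m_2$). *)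

theory Defs
  imports "Jordan_Normal_Form.DL_Rank"
begin

definition hadamard_vec :: "'a :: times vec \<Rightarrow> 'a vec \<Rightarrow> 'a vec" (infixl "\<odot>\<^sub>v" 70)
  where "u \<odot>\<^sub>v v = vec (dim_vec u) (\<lambda>i. u $ i * v $ i)"

text \<open>
  Indices start at 0 here, so the row number \<open>(i - 1) * m2 + j\<close> with \<open>1 \<le> i \<le> m1\<close> and
  \<open>1 \<le> j \<le> m2\<close> becomes \<open>i * m2 + j\<close> with \<open>i < m1\<close> and \<open>j < m2\<close>. Conversely,
  the row with number \<open>r\<close> belongs to \<open>i = r div m2\<close> and \<open>j = r mod m2\<close>.
\<close>
definition khatri_rao :: "'a :: times mat \<Rightarrow> 'a mat \<Rightarrow> 'a mat" (infixl "\<star>\<^sub>K\<^sub>R" 70)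
  where "A \<star>\<^sub>K\<^sub>R B =
    mat_of_rows (dim_col A)
      (map (\<lambda>r. row A (r div dim_row B) \<odot>\<^sub>v row B (r mod dim_row B))
        [0 ..< dim_row A * dim_row B])"

lemma khatri_rao_carrier:
  assumes "A \<in> carrier_mat m1 n" and "B \<in> carrier_mat m2 n"
  shows "A \<star>\<^sub>K\<^sub>R B \<in> carrier_mat (m1 * m2) n"
  using assms by (auto simp: khatri_rao_def)

lemma row_khatri_rao:
  assumes A: "A \<in> carrier_mat m1 n" and B: "B \<in> carrier_mat m2 n"
    and i: "i < m1" and j: "j < m2"
  shows "row (A \<star>\<^sub>K\<^sub>R B) (i * m2 + j) = row A i \<odot>\<^sub>v row B j"
proof -
  have "i * m2 + j < Suc i * m2" using j by simp
  also have "\<dots> \<le> m1 * m2" using i by (intro mult_le_mono1) simp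
  finally have r: "i * m2 + j < m1 * m2" .
  have "(i * m2 + j) div m2 = i" "(i * m2 + j) mod m2 = j"
    using j by auto
  then show ?thesis
    using A B r by (simp add: khatri_rao_def hadamard_vec_def)
qed

end

theory Submission
  imports Defs "Jordan_Normal_Form.Matrix_Kernel"
begin

text \<open>
  Put \<open>r = rank A\<close>, and write \<open>b\<^sub>j\<close> for the rows of \<open>B\<close>. Grouped by the rows of \<open>B\<close>, the
  equation \<open>(A \<star>\<^sub>K\<^sub>R B) *\<^sub>v \<alpha> = 1\<close> says that each vector \<open>b\<^sub>j \<odot>\<^sub>v \<alpha>\<close> solves the
  linear system \<open>A *\<^sub>v x = 1\<close>. Hence all these vectors lie in one translate of the kernel of
  \<open>A\<close>, which has dimension \<open>n - r\<close> by rank-nullity, and so they span a space of dimension at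
  most \<open>n - r + 1\<close>. Since \<open>\<alpha>\<close> has no zero entry, dividing entrywise by \<open>\<alpha>\<close> is possible
  and gives the same bound for the rows of \<open>B\<close>.

  The rank is defined here by columns. To avoid a separate proof that row rank and column rank
  agree, the statement about the rows is expressed as a factorization of \<open>B\<close> with inner
  dimension \<open>n - r + 1\<close> (\<open>rank_le_if_scaled_rows_in_kernel_translate\<close>), and such a
  factorization bounds the column rank directly (\<open>rank_mult_le_inner_dim\<close>).
\<close>

lemma (in vec_space) rank_le_of_col_space_subset:
  assumes A: "A \<in> carrier_mat n p" and B: "B \<in> carrier_mat n q"
    and sub: "col_space A \<subseteq> col_space B"
  shows "rank A \<le> rank B"
proof -
  have subA: "subspace class_ring (col_space A) V" and subB: "subspace class_ring (col_space B) V"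
    using A B cols_dim[of A] cols_dim[of B] span_is_subspace by (auto simp: col_space_def)
  have "subspace class_ring (col_space A) (vs (col_space B))"
    by (rule nested_subspaces[OF subB subA sub])
  moreover have "vectorspace class_ring (vs (col_space B))"
    by (rule subspace_is_vs[OF subB])
  ultimately show ?thesis
    using vectorspace.subspace_dim[of class_ring "vs (col_space B)" "col_space A"]
      fin_dim_span_cols[OF A] fin_dim_span_cols[OF B]
    unfolding rank_def col_space_def by simp
qed

lemma (in vec_space) rank_mult_le_inner_dim:
  assumes X: "X \<in> carrier_mat n k" and Y: "Y \<in> carrier_mat k q"
  shows "rank (X * Y) \<le> k"
proof -
  have XY: "X * Y \<in> carrier_mat n q" using X Y by simp
  have "col_space (X * Y) \<subseteq> col_space X"
    unfolding col_space_eq[OF XY] col_space_eq[OF X]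
    using X Y by (auto simp: assoc_mult_mat_vec[OF X Y])
  then have "rank (X * Y) \<le> rank X"
    by (rule rank_le_of_col_space_subset[OF XY X])
  also have "rank X \<le> k" by (rule rank_le_nc[OF X])
  finally show ?thesis .
qed

lemma rank_plus_kernel_dim:
  fixes A :: "'a :: field mat"
  assumes A: "A \<in> carrier_mat m n"
  shows "vec_space.rank m A + kernel_dim A = n"
proof -
  interpret V: vec_space "TYPE('a)" n .
  interpret W: vec_space "TYPE('a)" m .
  interpret K: kernel m n A by unfold_locales (rule A)
  have "(\<lambda>v. A *\<^sub>v v) \<in> LinearCombinations.module_hom class_ring V.V W.V"
    using A mult_add_distrib_mat_vec[OF A] mult_mat_vec[OF A]
    by (auto simp: LinearCombinations.module_hom_def)
  then interpret T: linear_map class_ring V.V W.V "\<lambda>v. A *\<^sub>v v"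
    by (intro linear_map.intro mod_hom.intro mod_hom_axioms.intro
        V.vectorspace_axioms W.vectorspace_axioms V.module_axioms W.module_axioms)
  have im: "T.im = W.col_space A"
    unfolding W.col_space_eq[OF A] T.im_def using A by auto
  have ker: "T.ker = mat_kernel A"
    unfolding T.ker_def mat_kernel_def using A by auto
  show ?thesis
    using T.rank_nullity[OF V.fin_dim]
    unfolding im ker V.dim_is_n W.rank_def W.col_space_def K.kernel_dim .
qed

text \<open>
  The columns of \<open>N\<close> are a basis of the kernel. Only the spanning property is stated, but it
  matters that their number is \<open>n - rank A\<close>.
\<close>
lemma kernel_parametrization:
  fixes A :: "'a :: field mat"
  assumes A: "A \<in> carrier_mat m n"
  obtains N where "N \<in> carrier_mat n (n - vec_space.rank m A)"
    and "\<And>v. v \<in> mat_kernel A \<Longrightarrow> \<exists>y \<in> carrier_vec (n - vec_space.rank m A). v = N *\<^sub>v y"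
proof -
  interpret K: kernel m n A by unfold_locales (rule A)
  obtain G where fin: "finite G" and basis: "K.basis G"
    using kernel_basis_exists[OF A] by blast
  have "card G = kernel_dim A"
    using K.Ker.dim_basis[OF fin basis] K.kernel_dim by simp
  then have card: "card G = n - vec_space.rank m A"
    using rank_plus_kernel_dim[OF A] by simp
  have GK: "G \<subseteq> mat_kernel A" and gen: "K.span G = mat_kernel A"
    using basis by (auto simp: K.Ker.basis_def)
  obtain gs where gs: "set gs = G" "distinct gs"
    using finite_distinct_list[OF fin] by blast
  then have len: "length gs = n - vec_space.rank m A"
    using card distinct_card by fastforce
  have carr: "set gs \<subseteq> carrier_vec n"
    using GK gs mat_kernel_carrier[OF A] by blast
  define N where "N = mat_of_cols n gs"
  have N: "N \<in> carrier_mat n (n - vec_space.rank m A)"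
    using mat_of_cols_carrier(1)[of n gs] by (simp only: N_def len)
  have "\<exists>y \<in> carrier_vec (n - vec_space.rank m A). v = N *\<^sub>v y" if "v \<in> mat_kernel A" for v
  proof -
    have "v \<in> K.NC.span (set gs)"
      using that gen K.span_same[OF GK] gs by simp
    then have "v \<in> K.NC.col_space N"
      using carr by (simp add: K.NC.col_space_def N_def)
    then show ?thesis
      unfolding K.NC.col_space_eq[OF N] using N by auto
  qed
  with N show ?thesis using that by blast
qed

text \<open>
  If the rows of \<open>B\<close>, rescaled entrywise by \<open>\<alpha>\<close>, lie in the translate of the kernel of
  \<open>A\<close> by a vector \<open>d\<close>, then \<open>B\<close> factors through a space of dimension
  \<open>n - rank A + 1\<close>; the summand 1 accounts for the direction \<open>d\<close>.
\<close>
lemma rank_le_if_scaled_rows_in_kernel_translate: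
  fixes A B :: "'a :: field mat"
  assumes A: "A \<in> carrier_mat m n" and B: "B \<in> carrier_mat p n"
    and nz: "\<And>k. k < n \<Longrightarrow> \<alpha> $ k \<noteq> 0"
    and d: "d \<in> carrier_vec n"
    and ker: "\<And>j. j < p \<Longrightarrow> row B j \<odot>\<^sub>v \<alpha> - d \<in> mat_kernel A"
  shows "vec_space.rank p B \<le> n - vec_space.rank m A + 1"
proof -
  define k where "k = n - vec_space.rank m A"
  obtain N where N: "N \<in> carrier_mat n k"
    and par: "\<And>v. v \<in> mat_kernel A \<Longrightarrow> \<exists>y \<in> carrier_vec k. v = N *\<^sub>v y"
    using kernel_parametrization[OF A] unfolding k_def by blast
  have "\<forall>j. \<exists>y. j < p \<longrightarrow> y \<in> carrier_vec k \<and> row B j \<odot>\<^sub>v \<alpha> - d = N *\<^sub>v y"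
    using par ker by blast
  then obtain y where y: "\<And>j. j < p \<Longrightarrow> y j \<in> carrier_vec k"
    and eq: "\<And>j. j < p \<Longrightarrow> row B j \<odot>\<^sub>v \<alpha> - d = N *\<^sub>v y j"
    by metis
  \<comment> \<open>Row \<open>j\<close> of \<open>B\<close> is \<open>N *\<^sub>v y j + d\<close> divided entrywise by \<open>\<alpha>\<close>: the first \<open>k\<close> inner
    indices carry the coordinates \<open>y j\<close>, the last one carries \<open>d\<close> with coefficient 1.\<close>
  define X where "X = mat p (k + 1) (\<lambda>(j, l). if l < k then y j $ l else 1)"
  define Y where "Y = mat (k + 1) n (\<lambda>(l, i). (if l < k then N $$ (i, l) else d $ i) / \<alpha> $ i)"
  have X: "X \<in> carrier_mat p (k + 1)" and Y: "Y \<in> carrier_mat (k + 1) n"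
    by (auto simp: X_def Y_def)
  have "B = X * Y"
  proof (rule eq_matI)
    fix j i assume "j < dim_row (X * Y)" "i < dim_col (X * Y)"
    then have j: "j < p" and i: "i < n" using X Y by auto
    have "(row B j \<odot>\<^sub>v \<alpha> - d) $ i = (N *\<^sub>v y j) $ i" by (simp add: eq[OF j])
    then have *: "B $$ (j, i) * \<alpha> $ i = (\<Sum>l<k. N $$ (i, l) * y j $ l) + d $ i"
      using B N d y[OF j] i j
      by (simp add: hadamard_vec_def scalar_prod_def atLeast0LessThan algebra_simps)
    have "(X * Y) $$ (j, i) = (\<Sum>l<k. y j $ l * (N $$ (i, l) / \<alpha> $ i)) + d $ i / \<alpha> $ i"
      using i j by (simp add: X_def Y_def scalar_prod_def atLeast0LessThan)
    also have "\<dots> = ((\<Sum>l<k. N $$ (i, l) * y j $ l) + d $ i) / \<alpha> $ i"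
      by (simp add: add_divide_distrib sum_divide_distrib mult.commute)
    also have "\<dots> = B $$ (j, i)"
      using nz[OF i] by (simp add: *[symmetric])
    finally show "B $$ (j, i) = (X * Y) $$ (j, i)" ..
  qed (use B X Y in auto)
  then show ?thesis
    using vec_space.rank_mult_le_inner_dim[OF X Y] by (simp add: k_def)
qed

lemma row_pair_index_less:
  fixes i j m1 m2 :: nat
  assumes "i < m1" and "j < m2"
  shows "i * m2 + j < m1 * m2"
proof -
  have "i * m2 + j < Suc i * m2" using assms(2) by simp
  also have "\<dots> \<le> m1 * m2" using assms(1) by (intro mult_le_mono1) simp
  finally show ?thesis .
qed

text \<open>
  The entries of the product with the Khatri-Rao matrix that belong to row \<open>j\<close> of \<open>B\<close> form
  \<open>A\<close> applied to that row, rescaled entrywise by \<open>\<alpha>\<close>.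
\<close>
lemma khatri_rao_mult_vec_index:
  fixes A B :: "'a :: comm_semiring_0 mat"
  assumes A: "A \<in> carrier_mat m1 n" and B: "B \<in> carrier_mat m2 n" and \<alpha>: "\<alpha> \<in> carrier_vec n"
    and i: "i < m1" and j: "j < m2"
  shows "((A \<star>\<^sub>K\<^sub>R B) *\<^sub>v \<alpha>) $ (i * m2 + j) = (A *\<^sub>v (row B j \<odot>\<^sub>v \<alpha>)) $ i"
proof -
  have "((A \<star>\<^sub>K\<^sub>R B) *\<^sub>v \<alpha>) $ (i * m2 + j) = (row A i \<odot>\<^sub>v row B j) \<bullet> \<alpha>"
    using khatri_rao_carrier[OF A B] row_khatri_rao[OF A B i j] row_pair_index_less[OF i j] by simp
  also have "\<dots> = row A i \<bullet> (row B j \<odot>\<^sub>v \<alpha>)"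
    using A B \<alpha> i j by (simp add: scalar_prod_def hadamard_vec_def mult.assoc)
  finally show ?thesis using A i by simp
qed

theorem theorem17:
  fixes A B :: "real mat" and \<alpha> :: "real vec" and m1 m2 n :: nat
  assumes "A \<in> carrier_mat m1 n"
    and "B \<in> carrier_mat m2 n"
    and "\<alpha> \<in> carrier_vec n"
    and "\<forall>i<n. \<alpha> $ i \<noteq> 0"
    and "(A \<star>\<^sub>K\<^sub>R B) *\<^sub>v \<alpha> = vec (m1 * m2) (\<lambda>_. 1)"
  shows "int (vec_space.rank m1 A) + int (vec_space.rank m2 B) - 1 \<le> int n"
proof -
  note A = assms(1) and B = assms(2) and \<alpha> = assms(3)
  \<comment> \<open>If \<open>B\<close> has no rows, \<open>d\<close> has unspecified entries but still dimension \<open>n\<close>, and the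
    claims about the rows of \<open>B\<close> are vacuous.\<close>
  define d where "d = row B 0 \<odot>\<^sub>v \<alpha>"
  have carr: "row B j \<odot>\<^sub>v \<alpha> \<in> carrier_vec n" for j
    using B by (simp add: hadamard_vec_def)
  have ones: "A *\<^sub>v (row B j \<odot>\<^sub>v \<alpha>) = vec m1 (\<lambda>_. 1)" if j: "j < m2" for j
  proof (rule eq_vecI)
    fix i assume "i < dim_vec (vec m1 (\<lambda>_. 1 :: real))"
    then have i: "i < m1" by simp
    show "(A *\<^sub>v (row B j \<odot>\<^sub>v \<alpha>)) $ i = vec m1 (\<lambda>_. 1) $ i"
      using khatri_rao_mult_vec_index[OF A B \<alpha> i j] row_pair_index_less[OF i j] assms(5) i by simp
  qed (use A in simp)
  have "row B j \<odot>\<^sub>v \<alpha> - d \<in> mat_kernel A" if j: "j < m2" for j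
  proof (rule mat_kernelI[OF A])
    have "A *\<^sub>v (row B j \<odot>\<^sub>v \<alpha> - d) = A *\<^sub>v (row B j \<odot>\<^sub>v \<alpha>) - A *\<^sub>v d"
      unfolding d_def by (rule mult_minus_distrib_mat_vec[OF A carr carr])
    also have "\<dots> = 0\<^sub>v m1"
      using ones[OF j] ones[of 0] j by (auto simp: d_def)
    finally show "A *\<^sub>v (row B j \<odot>\<^sub>v \<alpha> - d) = 0\<^sub>v m1" .
  qed (use carr in \<open>auto simp: d_def\<close>)
  then have "vec_space.rank m2 B \<le> n - vec_space.rank m1 A + 1"
    using rank_le_if_scaled_rows_in_kernel_translate[OF A B, of \<alpha> d] assms(4) carr[of 0]
    by (simp add: d_def)
  moreover have "vec_space.rank m1 A \<le> n"
    by (rule vec_space.rank_le_nc[OF A])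
  ultimately show ?thesis by linarith
qed

end
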